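(* Let $\alpha>-1$, $\beta>0$ and let $n$ be a positive integer with $n>\beta$. Then for every integer $r\ge 0$ and every $x\ge 0$, $$M_n^{(\alpha,\beta)}[t^r](x)=\frac{(\alpha+1)_r}{(n-\beta)^r}\,e^{-nx}\,{}_1F_1(\alpha+r+1;\,\alpha+1;\,nx).$$
   Context: For $k=0,1,2,\dots$ and $x\ge 0$ put $\psi_{n,k}(x)=\dfrac{(nx)^k e^{-nx}}{k!}$. The operator $M_n^{(\alpha,\beta)}$ is $$M_n^{(\alpha,\beta)}[f](x)=\sum_{k=0}^{\infty}\left(\frac{(n-\beta)^{k+\alpha+1}}{\Gamma(k+\alpha+1)}\int_0^\infty f(t)\,t^{k+\alpha}e^{-(n-\beta)t}\,dt\right)\psi_{n,k}(x),\qquad x\ge 0.$$ $M_n^{(\alpha,\beta)}[t^r]$ denotes the operator applied to the function $t\mapsto t^r$. The rising factorial is $(a)_0=1$, $(a)_r=a(a+1)\cdots(a+r-1)$, and ${}_1F_1(a;b;z)=\sum_{k\ge 0}\frac{(a)_k}{(b)_k}\frac{z^k}{k!}$ is the confluent hypergeometric function. *)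

theory Defs
  imports "HOL-Analysis.Analysis"
begin

definition psi :: "nat \<Rightarrow> nat \<Rightarrow> real \<Rightarrow> real" where
  "psi n k x = (real n * x) ^ k * exp (- (real n * x)) / fact k"

definition M_integrand :: "real \<Rightarrow> real \<Rightarrow> nat \<Rightarrow> (real \<Rightarrow> real) \<Rightarrow> nat \<Rightarrow> real \<Rightarrow> real" where
  "M_integrand \<alpha> \<beta> n f k t = f t * t powr (real k + \<alpha>) * exp (- ((real n - \<beta>) * t))"

definition M_coeff :: "real \<Rightarrow> real \<Rightarrow> nat \<Rightarrow> (real \<Rightarrow> real) \<Rightarrow> nat \<Rightarrow> real" where
  "M_coeff \<alpha> \<beta> n f k =
     (real n - \<beta>) powr (real k + \<alpha> + 1) / Gamma (real k + \<alpha> + 1) *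
     (LINT t:{0..}|lborel. M_integrand \<alpha> \<beta> n f k t)"

definition M_op :: "real \<Rightarrow> real \<Rightarrow> nat \<Rightarrow> (real \<Rightarrow> real) \<Rightarrow> real \<Rightarrow> real" where
  "M_op \<alpha> \<beta> n f x = (\<Sum>k. M_coeff \<alpha> \<beta> n f k * psi n k x)"

text \<open>
  The integral and the series in \<^const>\<open>M_op\<close> are total functions in HOL. The following
  predicate says that they actually converge, so that the value of \<^const>\<open>M_op\<close> is the
  intended one and not a default value.
\<close>
definition M_op_converges :: "real \<Rightarrow> real \<Rightarrow> nat \<Rightarrow> (real \<Rightarrow> real) \<Rightarrow> real \<Rightarrow> bool" where
  "M_op_converges \<alpha> \<beta> n f x \<longleftrightarrow>
     (\<forall>k. set_integrable lborel {0..} (M_integrand \<alpha> \<beta> n f k)) \<and>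
     summable (\<lambda>k. M_coeff \<alpha> \<beta> n f k * psi n k x)"

definition hyp1F1 :: "real \<Rightarrow> real \<Rightarrow> real \<Rightarrow> real" where
  "hyp1F1 a b z = (\<Sum>k. pochhammer a k / pochhammer b k * z ^ k / fact k)"

lemma summable_hyp1F1:
  fixes a b z :: real
  assumes b: "b > 0"
  shows "summable (\<lambda>k. pochhammer a k / pochhammer b k * z ^ k / fact k)"
proof -
  define c where "c = (\<lambda>k. pochhammer a k / pochhammer b k * z ^ k / fact k)"
  have c_Suc: "c (Suc k) = c k * ((a + real k) * z / ((b + real k) * (real k + 1)))" for k
    by (simp add: c_def pochhammer_Suc mult_ac add_ac)
  have "(\<lambda>k. \<bar>(a + real k) * z / ((b + real k) * (real k + 1))\<bar>) \<longlonglongrightarrow> 0"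
  proof -
    have 1: "(\<lambda>k. (a - b) / (b + real k)) \<longlonglongrightarrow> 0" "(\<lambda>k. z / (1 + real k)) \<longlonglongrightarrow> 0"
      by (rule tendsto_divide_0[OF tendsto_const]
               filterlim_at_top_imp_at_infinity
               filterlim_tendsto_add_at_top[OF tendsto_const filterlim_real_sequentially])+
    have "(\<lambda>k. (1 + (a - b) / (b + real k)) * (z / (1 + real k))) \<longlonglongrightarrow> (1 + 0) * 0"
      by (intro tendsto_intros 1)
    moreover have "(1 + (a - b) / (b + real k)) * (z / (1 + real k)) =
        (a + real k) * z / ((b + real k) * (real k + 1))" for k
    proof -
      have "b + real k \<noteq> 0" using b by linarith
      then have "1 + (a - b) / (b + real k) = (a + real k) / (b + real k)"
        by (simp add: field_simps)
      then show ?thesis by (simp add: add_ac)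
    qed
    ultimately have "(\<lambda>k. (a + real k) * z / ((b + real k) * (real k + 1))) \<longlonglongrightarrow> 0"
      by simp
    then show ?thesis by (rule tendsto_rabs_zero)
  qed
  then have "\<forall>\<^sub>F k in sequentially. \<bar>(a + real k) * z / ((b + real k) * (real k + 1))\<bar> < 1 / 2"
    by (rule order_tendstoD) simp
  then obtain N where
    N: "\<And>k. k \<ge> N \<Longrightarrow> \<bar>(a + real k) * z / ((b + real k) * (real k + 1))\<bar> < 1 / 2"
    by (auto simp: eventually_sequentially)
  have "summable c"
  proof (rule summable_ratio_test)
    show "(1 / 2 :: real) < 1" by simp
    show "norm (c (Suc k)) \<le> 1 / 2 * norm (c k)" if "k \<ge> N" for k
    proof -
      have "norm (c (Suc k)) = norm (c k) * \<bar>(a + real k) * z / ((b + real k) * (real k + 1))\<bar>"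
        by (simp only: c_Suc real_norm_def abs_mult[of "c k"])
      also have "\<dots> \<le> norm (c k) * (1 / 2)"
        using N[OF that] by (intro mult_left_mono) auto
      finally show ?thesis by simp
    qed
  qed
  then show ?thesis by (simp add: c_def)
qed

end

theory Submission
  imports Defs
begin

text \<open>
  Each coefficient is a Gamma integral: for $f(t) = t^r$ and $a = \alpha + 1$ it equals
  $\Gamma(a+k+r) / (\Gamma(a+k) (n-\beta)^r) = (a+k)_r / (n-\beta)^r$. Splitting $(a)_{k+r}$ in two
  ways gives $(a)_k (a+k)_r = (a)_r (a+r)_k$, which turns the series into that of
  ${}_1F_1(a+r; a; nx)$.
\<close>

text \<open>Euler's integral for \<open>Gamma s\<close> after the substitution t -> c t.\<close>

lemma has_bochner_integral_Gamma_real: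
  fixes s c :: real
  assumes s: "s > 0" and c: "c > 0"
  shows "has_bochner_integral lborel
           (\<lambda>t. indicator {0..} t *\<^sub>R (t powr (s - 1) * exp (- (c * t)))) (Gamma s / c powr s)"
proof -
  let ?g = "\<lambda>t::real. indicator {0..} t * t powr (s - 1) / exp t"
  \<comment> \<open>The integrand is nonnegative, so its finite \<open>nn_integral\<close> gives
    integrability and value at once.\<close>
  have "has_bochner_integral lborel ?g (Gamma s)"
    by (rule has_bochner_integral_nn_integral)
       (use Gamma_conv_nn_integral_real[OF s] Gamma_real_pos[OF s] in auto)
  then have "has_bochner_integral lborel (\<lambda>t. ?g (0 + c * t)) (Gamma s /\<^sub>R \<bar>c\<bar>)"
    using c by (subst (asm) lborel_has_bochner_integral_real_affine_iff[where c = c and t = 0]) auto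
  \<comment> \<open>The factor \<open>c powr (1 - s)\<close> cancels the power of c released by
    \<open>(c * t) powr (s - 1)\<close>; with the Jacobian 1/c it leaves \<open>c powr (- s)\<close>
    in the value.\<close>
  then have "has_bochner_integral lborel (\<lambda>t. c powr (1 - s) * ?g (0 + c * t))
               (c powr (1 - s) * (Gamma s /\<^sub>R \<bar>c\<bar>))"
    by (rule has_bochner_integral_mult_right)
  moreover have "c powr (1 - s) * ?g (0 + c * t) =
                   indicator {0..} t *\<^sub>R (t powr (s - 1) * exp (- (c * t)))" for t
  proof (cases "t \<ge> 0")
    case True
    have "c powr (1 - s) * (c * t) powr (s - 1) = t powr (s - 1)"
      using True c by (simp add: powr_mult flip: powr_add mult.assoc)
    then show ?thesis
      using True c by (simp add: exp_minus divide_inverse flip: mult.assoc)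
  next
    case False
    then show ?thesis
      using c by (simp add: zero_le_mult_iff)
  qed
  moreover have "c powr (1 - s) * (Gamma s /\<^sub>R \<bar>c\<bar>) = Gamma s / c powr s"
    using c by (simp add: powr_diff field_simps)
  ultimately show ?thesis
    by simp
qed

text \<open>The right-hand side isolates a factor free of k from the quotient that occurs in the 1F1
  series; a > 0 makes the divisor \<open>pochhammer a k\<close> nonzero.\<close>

lemma pochhammer_shift_eq:
  fixes a :: real
  assumes "a > 0"
  shows "pochhammer (a + real k) r = pochhammer a r * (pochhammer (a + real r) k / pochhammer a k)"
proof -
  have "pochhammer a k * pochhammer (a + real k) r = pochhammer a r * pochhammer (a + real r) k"
    by (metis add.commute pochhammer_product')
  then show ?thesis
    using pochhammer_pos[OF assms, of k] by (simp add: field_simps)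
qed

text \<open>The power t^r only shifts the exponent, so this is the Gamma integral with s = k +
  \<alpha> + 1 + r and c = n - \<beta>. The Bochner form serves both the value of
  \<open>M_coeff\<close> and the integrability in \<open>M_op_converges\<close>.\<close>

lemma has_bochner_integral_M_integrand_power:
  assumes "\<alpha> > -1" and "real n > \<beta>"
  shows "has_bochner_integral lborel
           (\<lambda>t. indicator {0..} t *\<^sub>R M_integrand \<alpha> \<beta> n (\<lambda>t. t ^ r) k t)
           (Gamma (real k + \<alpha> + 1 + real r) / (real n - \<beta>) powr (real k + \<alpha> + 1 + real r))"
proof -
  have eq: "indicator {0..} t *\<^sub>R (t powr (real k + \<alpha> + 1 + real r - 1) * exp (- ((real n - \<beta>) * t))) =
        indicator {0..} t *\<^sub>R M_integrand \<alpha> \<beta> n (\<lambda>t. t ^ r) k t" for t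
  proof (cases "t > 0")
    case True
    then show ?thesis
      by (simp add: M_integrand_def algebra_simps powr_add flip: powr_realpow)
  \<comment> \<open>At t = 0 both sides vanish, even for r = 0 or a negative exponent, because
    \<open>0 powr a = 0\<close> for every a; for t < 0 the indicator is 0.\<close>
  next
    case False
    then show ?thesis
      by (cases "t = 0") (simp_all add: M_integrand_def)
  qed
  have "real k + \<alpha> + 1 + real r > 0" and "real n - \<beta> > 0"
    using assms by simp_all
  from has_bochner_integral_Gamma_real[OF this] show ?thesis
    by (simp only: eq)
qed

lemma M_coeff_power:
  assumes "\<alpha> > -1" and "real n > \<beta>"
  shows "M_coeff \<alpha> \<beta> n (\<lambda>t. t ^ r) k =
           pochhammer (\<alpha> + 1) r / (real n - \<beta>) ^ r *
             (pochhammer (\<alpha> + real r + 1) k / pochhammer (\<alpha> + 1) k)"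
proof -
  let ?b = "real k + \<alpha> + 1" and ?c = "real n - \<beta>"
  have b: "?b > 0" and c: "?c > 0"
    using assms by simp_all
  have "(LINT t:{0..}|lborel. M_integrand \<alpha> \<beta> n (\<lambda>t. t ^ r) k t) =
          Gamma (?b + real r) / ?c powr (?b + real r)"
    using has_bochner_integral_integral_eq[OF has_bochner_integral_M_integrand_power[OF assms]]
    by (simp add: set_lebesgue_integral_def)
  then have "M_coeff \<alpha> \<beta> n (\<lambda>t. t ^ r) k =
               ?c powr ?b / Gamma ?b * (Gamma (?b + real r) / ?c powr (?b + real r))"
    by (simp only: M_coeff_def)
  also have "\<dots> = Gamma (?b + real r) / Gamma ?b / ?c ^ r"
    using c by (simp add: powr_add powr_realpow)
  \<comment> \<open>Positivity of \<open>?b\<close> keeps it away from the poles of Gamma.\<close>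
  also have "Gamma (?b + real r) / Gamma ?b = pochhammer ?b r"
    using b by (subst pochhammer_Gamma) (auto elim!: nonpos_Ints_cases)
  also have "pochhammer ?b r =
      pochhammer (\<alpha> + 1) r * (pochhammer (\<alpha> + real r + 1) k / pochhammer (\<alpha> + 1) k)"
    using pochhammer_shift_eq[of "\<alpha> + 1" k r] assms by (simp add: add_ac)
  finally show ?thesis
    by simp
qed

theorem mainTheorem1:
  fixes \<alpha> \<beta> x :: real and n r :: nat
  assumes "\<alpha> > -1" and "\<beta> > 0" and "n > 0" and "real n > \<beta>" and "x \<ge> 0"
  shows "M_op_converges \<alpha> \<beta> n (\<lambda>t. t ^ r) x \<and>
         M_op \<alpha> \<beta> n (\<lambda>t. t ^ r) x =
           pochhammer (\<alpha> + 1) r / (real n - \<beta>) ^ r * exp (- (real n * x)) *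
             hyp1F1 (\<alpha> + real r + 1) (\<alpha> + 1) (real n * x)"
proof -
  let ?C = "pochhammer (\<alpha> + 1) r / (real n - \<beta>) ^ r * exp (- (real n * x))"
  let ?h = "\<lambda>k. pochhammer (\<alpha> + real r + 1) k / pochhammer (\<alpha> + 1) k * (real n * x) ^ k / fact k"
  \<comment> \<open>The exponential in \<open>psi\<close> does not depend on k and joins the
    constant \<open>?C\<close>, so convergence of the 1F1 series gives both the convergence and the
    sum of the operator series.\<close>
  have "M_coeff \<alpha> \<beta> n (\<lambda>t. t ^ r) k * psi n k x = ?C * ?h k" for k
    by (simp add: M_coeff_power[OF assms(1,4)] psi_def mult_ac)
  moreover have "?h sums hyp1F1 (\<alpha> + real r + 1) (\<alpha> + 1) (real n * x)"
    unfolding hyp1F1_def using assms by (intro summable_sums summable_hyp1F1) simp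
  ultimately have sums: "(\<lambda>k. M_coeff \<alpha> \<beta> n (\<lambda>t. t ^ r) k * psi n k x) sums
                     (?C * hyp1F1 (\<alpha> + real r + 1) (\<alpha> + 1) (real n * x))"
    by (simp only: sums_mult)
  have "set_integrable lborel {0..} (M_integrand \<alpha> \<beta> n (\<lambda>t. t ^ r) k)" for k
    using has_bochner_integral_M_integrand_power[OF assms(1,4)]
    by (auto simp: set_integrable_def has_bochner_integral_iff)
  then show ?thesis
    using sums_summable[OF sums] sums_unique[OF sums]
    by (simp add: M_op_converges_def M_op_def)
qed

end
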